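(* For every odd $m\ge3$, $$\operatorname{Con}(H_m)=\{\Delta,\lambda,\mu,\nu,\alpha,\pi,\beta,\nabla\}.$$ With equivalences ordered by inclusion, this lattice is isomorphic to the Boolean lattice $B_3$ (the Boolean lattice with three atoms). Its atoms are $\lambda,\mu,\nu$, and $$\lambda\vee\mu=\pi,\qquad \mu\vee\nu=\alpha,\qquad \lambda\vee\nu=\beta.$$
   Context: Let $X=\{1,2,3,4\}$, let $\epsilon:X\to\mathbb Z_2$ be given by $\epsilon(1)=\epsilon(4)=0$, $\epsilon(2)=\epsilon(3)=1$, and let $\eta:\mathbb Z_2\to X$ be $\eta(0)=4$, $\eta(1)=3$. For odd $m\ge3$, $H_m:X^m\to X$ is defined by: $H_m(x_1,\dots,x_m)=1$ if $x_1=\dots=x_m=1$; $=2$ if $x_1=\dots=x_m=2$; and $=\eta(\epsilon(x_1)+\dots+\epsilon(x_m))$ otherwise, with the sum taken in $\mathbb Z_2$. $\operatorname{Con}(H_m)$ is the set of equivalence relations on $X$ compatible with $H_m$. Partitions are written by concatenating the elements of a block and separating blocks by bars; the named equivalences are $\Delta=1|2|3|4$, $\lambda=1|23|4$, $\mu=14|2|3$, $\nu=1|2|34$, $\alpha=134|2$, $\pi=14|23$, $\beta=1|234$, $\nabla=1234$. *)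

theory Defs
  imports "HOL-Algebra.Complete_Lattice" "HOL-Library.FuncSet" "HOL-Library.Z2"
begin

definition X :: "nat set" where
  "X = {1, 2, 3, 4}"

text \<open>\<open>bit\<close> is the field \<open>\<int>/2\<int>\<close>. The values of \<open>eps\<close> outside \<open>X\<close> are irrelevant.\<close>

definition eps :: "nat \<Rightarrow> bit" where
  "eps x = (if x = 2 \<or> x = 3 then 1 else 0)"

definition eta :: "bit \<Rightarrow> nat" where
  "eta b = (if b = 0 then 4 else 3)"

text \<open>An \<open>m\<close>-tuple over \<open>A\<close> is an element of \<open>{1..m} \<rightarrow>\<^sub>E A\<close>.\<close>

definition H :: "nat \<Rightarrow> (nat \<Rightarrow> nat) \<Rightarrow> nat" where
  "H m x =
     (if \<forall>i\<in>{1..m}. x i = 1 then 1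
      else if \<forall>i\<in>{1..m}. x i = 2 then 2
      else eta (\<Sum>i=1..m. eps (x i)))"

lemma H_closed: "x \<in> {1..m} \<rightarrow>\<^sub>E X \<Longrightarrow> H m x \<in> X"
  by (simp add: H_def X_def eta_def)

definition compatible :: "'a set \<Rightarrow> nat \<Rightarrow> ((nat \<Rightarrow> 'a) \<Rightarrow> 'a) \<Rightarrow> 'a rel \<Rightarrow> bool" where
  "compatible A m f R \<longleftrightarrow>
     (\<forall>x \<in> {1..m} \<rightarrow>\<^sub>E A. \<forall>y \<in> {1..m} \<rightarrow>\<^sub>E A.
        (\<forall>i\<in>{1..m}. (x i, y i) \<in> R) \<longrightarrow> (f x, f y) \<in> R)"

definition Con :: "'a set \<Rightarrow> nat \<Rightarrow> ((nat \<Rightarrow> 'a) \<Rightarrow> 'a) \<Rightarrow> 'a rel set" where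
  "Con A m f = {R. equiv A R \<and> compatible A m f R}"

definition rel_of_partition :: "'a set set \<Rightarrow> 'a rel" where
  "rel_of_partition P = (\<Union>B\<in>P. B \<times> B)"

definition eq_Delta :: "nat rel" where
  "eq_Delta = rel_of_partition {{1}, {2}, {3}, {4}}"

definition eq_lambda :: "nat rel" where
  "eq_lambda = rel_of_partition {{1}, {2, 3}, {4}}"

definition eq_mu :: "nat rel" where
  "eq_mu = rel_of_partition {{1, 4}, {2}, {3}}"

definition eq_nu :: "nat rel" where
  "eq_nu = rel_of_partition {{1}, {2}, {3, 4}}"

definition eq_alpha :: "nat rel" where
  "eq_alpha = rel_of_partition {{1, 3, 4}, {2}}"

definition eq_pi :: "nat rel" where
  "eq_pi = rel_of_partition {{1, 4}, {2, 3}}"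

definition eq_beta :: "nat rel" where
  "eq_beta = rel_of_partition {{1}, {2, 3, 4}}"

definition eq_nabla :: "nat rel" where
  "eq_nabla = rel_of_partition {{1, 2, 3, 4}}"

definition inclusion_order :: "'a set set \<Rightarrow> 'a set gorder" where
  "inclusion_order S = \<lparr>carrier = S, eq = (=), le = (\<subseteq>)\<rparr>"

definition boolean_lattice :: "nat \<Rightarrow> nat set gorder" where
  "boolean_lattice n = inclusion_order (Pow {..<n})"

text \<open>\<open>join_pres\<close> and \<open>meet_pres\<close> include the condition that both orders are lattices.\<close>

definition lattice_isomorphic ::
    "('a, 'c) gorder_scheme \<Rightarrow> ('b, 'd) gorder_scheme \<Rightarrow> bool" where
  "lattice_isomorphic L M \<longleftrightarrow>
     (\<exists>f. bij_betw f (carrier L) (carrier M) \<and> join_pres L M f \<and> meet_pres L M f)"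

definition atoms :: "('a, 'b) gorder_scheme \<Rightarrow> 'a set" where
  "atoms L = {a \<in> carrier L. a \<noteq> \<bottom>\<^bsub>L\<^esub> \<and>
                (\<forall>x\<in>carrier L. x \<sqsubseteq>\<^bsub>L\<^esub> a \<longrightarrow> x = \<bottom>\<^bsub>L\<^esub> \<or> x = a)}"

end

theory Submission
  imports Defs
begin

text \<open>
  The three maps \<open>x \<mapsto> [x = 1]\<close>, \<open>eps\<close> and \<open>x \<mapsto> [x = 2]\<close> are homomorphisms on \<open>H m\<close> (for \<open>eps\<close>
  because \<open>m\<close> is odd), so every intersection of their kernels \<open>\<beta>\<close>, \<open>\<pi>\<close>, \<open>\<alpha>\<close> is a congruence.
  Conversely, arrange \<open>X\<close> as the path \<open>1 - 4 - 3 - 2\<close>. Evaluating \<open>H m\<close> on tuples that are constant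
  apart from two entries shows that a congruence relating two elements relates all elements on the
  path between them. So it is determined by the set of edges of the path that it contains, and this
  set can be any subset of the three edges.
\<close>

section \<open>Inclusion orders that are copies of a powerset\<close>

text \<open>An order embedding of a powerset is an isomorphism onto its image, so bounds, atoms and
  the Boolean structure can be read off index sets. Nothing forces \<open>h (I \<union> J)\<close>
  to be \<open>h I \<union> h J\<close>: a join of equivalences is usually larger than their
  union.\<close>

locale powerset_embedding =
  fixes A :: "'a set" and h :: "'a set \<Rightarrow> 'b set"
  assumes subset_iff: "I \<subseteq> A \<Longrightarrow> J \<subseteq> A \<Longrightarrow> h I \<subseteq> h J \<longleftrightarrow> I \<subseteq> J"
begin

abbreviation L :: "'b set gorder" where
  "L \<equiv> inclusion_order (h ` Pow A)"

lemma eq_iff: "I \<subseteq> A \<Longrightarrow> J \<subseteq> A \<Longrightarrow> h I = h J \<longleftrightarrow> I = J"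
  using subset_iff[of I J] subset_iff[of J I] by auto

lemma inj: "inj_on h (Pow A)"
  by (auto simp: inj_on_def eq_iff)

lemma L_simps [simp]: "carrier L = h ` Pow A" "le L = (\<subseteq>)"
  by (simp_all add: inclusion_order_def)

text \<open>Upper bounds are sought inside the image only. Such a bound is some \<open>h K\<close>,
  and reflecting the order turns the two inclusions into
  \<open>I \<union> J \<subseteq> K\<close>.\<close>

lemma least_join:
  assumes "I \<subseteq> A" "J \<subseteq> A"
  shows "least L (h (I \<union> J)) (Upper L {h I, h J})"
proof (rule least_UpperI)
  fix x assume "x \<in> {h I, h J}"
  then consider "x = h I" | "x = h J" by blast
  then show "le L x (h (I \<union> J))"
    by cases (use assms in \<open>simp_all add: subset_iff\<close>)
next
  fix y assume "y \<in> Upper L {h I, h J}"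
  then have "y \<in> h ` Pow A" "h I \<subseteq> y" "h J \<subseteq> y"
    using assms by (simp_all add: Upper_def)
  then obtain K where "K \<subseteq> A" "y = h K" "h I \<subseteq> h K" "h J \<subseteq> h K"
    by (elim imageE) simp
  then show "le L (h (I \<union> J)) y"
    using assms by (simp add: subset_iff)
qed (use assms in simp_all)

lemma greatest_meet:
  assumes "I \<subseteq> A" "J \<subseteq> A"
  shows "greatest L (h (I \<inter> J)) (Lower L {h I, h J})"
proof (rule greatest_LowerI)
  have IJ: "I \<inter> J \<subseteq> A" using assms by blast
  then show "h (I \<inter> J) \<in> carrier L" by simp
  fix x assume "x \<in> {h I, h J}"
  then consider "x = h I" | "x = h J" by blast
  then show "le L (h (I \<inter> J)) x"
    by cases (use assms IJ in \<open>simp_all add: subset_iff\<close>)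
next
  have IJ: "I \<inter> J \<subseteq> A" using assms by blast
  fix y assume "y \<in> Lower L {h I, h J}"
  then have "y \<in> h ` Pow A" "y \<subseteq> h I" "y \<subseteq> h J"
    using assms by (simp_all add: Lower_def)
  then obtain K where "K \<subseteq> A" "y = h K" "h K \<subseteq> h I" "h K \<subseteq> h J"
    by (elim imageE) simp
  then show "le L y (h (I \<inter> J))"
    using assms IJ by (simp add: subset_iff)
qed (use assms in simp_all)

lemma partial_order: "partial_order L"
  by unfold_locales (auto simp: inclusion_order_def)

lemma lattice: "lattice L"
proof -
  interpret partial_order L by (rule partial_order)
  show ?thesis
  proof
    fix x y assume "x \<in> carrier L" "y \<in> carrier L"
    then obtain I J where "I \<subseteq> A" "J \<subseteq> A" "x = h I" "y = h J"
      unfolding L_simps by blast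
    then show "\<exists>s. least L s (Upper L {x, y})" "\<exists>s. greatest L s (Lower L {x, y})"
      using least_join[of I J] greatest_meet[of I J] by blast+
  qed
qed

lemma join:
  assumes "I \<subseteq> A" "J \<subseteq> A"
  shows "h I \<squnion>\<^bsub>L\<^esub> h J = h (I \<union> J)"
proof -
  interpret lattice L by (rule lattice)
  show ?thesis
    \<comment> \<open>A join is a chosen least upper bound; antisymmetry makes it unique, so the
      choice must return the one already found.\<close>
    unfolding join_def sup_def
    using some_equality[where P = "\<lambda>x. least L x (Upper L {h I, h J})",
        OF least_join[OF assms] least_unique[OF _ least_join[OF assms]]] .
qed

lemma meet:
  assumes "I \<subseteq> A" "J \<subseteq> A"
  shows "h I \<sqinter>\<^bsub>L\<^esub> h J = h (I \<inter> J)"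
proof -
  interpret lattice L by (rule lattice)
  show ?thesis
    unfolding meet_def inf_def
    using some_equality[where P = "\<lambda>x. greatest L x (Lower L {h I, h J})",
        OF greatest_meet[OF assms] greatest_unique[OF _ greatest_meet[OF assms]]] .
qed

lemma bottom: "\<bottom>\<^bsub>L\<^esub> = h {}"
proof -
  interpret partial_order L by (rule partial_order)
  have least: "least L (h {}) (carrier L)"
    unfolding least_def L_simps using subset_iff[of "{}"] by blast
  show ?thesis
    unfolding bottom_def
    using some_equality[where P = "\<lambda>x. least L x (carrier L)", OF least least_unique[OF _ least]] .
qed

text \<open>Atoms are defined by order alone, so \<open>h\<close> carries the atoms of the powerset,
  its singletons, to those of the image.\<close>

lemma atoms: "atoms L = (\<lambda>a. h {a}) ` A"
proof -
  have singleton: "(\<forall>J. J \<subseteq> A \<and> J \<subseteq> I \<longrightarrow> J = {} \<or> J = I) \<and> I \<noteq> {} \<longleftrightarrow> (\<exists>a\<in>A. I = {a})"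
    if "I \<subseteq> A" for I
  proof
    assume I: "(\<forall>J. J \<subseteq> A \<and> J \<subseteq> I \<longrightarrow> J = {} \<or> J = I) \<and> I \<noteq> {}"
    then obtain a where "a \<in> I" by blast
    with I that have "{a} = I" by (metis empty_not_insert insert_subset empty_subsetI subsetD)
    with that show "\<exists>a\<in>A. I = {a}" by blast
  qed auto
  have mem: "h I \<in> atoms L \<longleftrightarrow> (\<exists>a\<in>A. I = {a})" if "I \<subseteq> A" for I
  proof -
    have "h I \<in> atoms L \<longleftrightarrow>
        h I \<noteq> h {} \<and> (\<forall>J. J \<subseteq> A \<longrightarrow> h J \<subseteq> h I \<longrightarrow> h J = h {} \<or> h J = h I)"
      using that by (simp add: atoms_def bottom del: Pow_iff) blast
    also have "\<dots> \<longleftrightarrow> (\<forall>J. J \<subseteq> A \<and> J \<subseteq> I \<longrightarrow> J = {} \<or> J = I) \<and> I \<noteq> {}"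
      using that subset_iff eq_iff by (metis empty_subsetI)
    finally show ?thesis
      unfolding singleton[OF that] .
  qed
  show ?thesis
  proof (intro subset_antisym subsetI)
    fix x assume x: "x \<in> atoms L"
    then obtain I where I: "I \<subseteq> A" "x = h I"
      by (auto simp: atoms_def)
    with x mem[OF I(1)] show "x \<in> (\<lambda>a. h {a}) ` A" by blast
  next
    fix x assume "x \<in> (\<lambda>a. h {a}) ` A"
    then obtain a where "a \<in> A" "x = h {a}" by blast
    with mem[of "{a}"] show "x \<in> atoms L" by simp
  qed
qed

lemma lattice_isomorphic: "lattice_isomorphic L (inclusion_order (Pow A))"
proof -
  \<comment> \<open>The powerset is its own image under the identity, so its joins and meets come
    from the same lemmas.\<close>
  interpret P: powerset_embedding A "\<lambda>I. I"
    by unfold_locales simp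
  let ?f = "inv_into (Pow A) h"
  have f: "?f (h I) = I" if "I \<subseteq> A" for I
    using that inj by simp
  have "bij_betw ?f (carrier L) (carrier (inclusion_order (Pow A)))"
    using bij_betw_inv_into[OF inj_on_imp_bij_betw[OF inj]] by (simp add: inclusion_order_def)
  moreover have "join_pres L (inclusion_order (Pow A)) ?f"
    using lattice P.lattice P.join
    by (auto simp: join_pres_def join f)
  moreover have "meet_pres L (inclusion_order (Pow A)) ?f"
    using lattice P.lattice P.meet
    by (auto simp: meet_pres_def meet f le_infI1)
  ultimately show ?thesis
    unfolding lattice_isomorphic_def by blast
qed

end

section \<open>Intersections of the three kernels\<close>

text \<open>The index \<open>0\<close>, \<open>1\<close>, \<open>2\<close> stands for the edge \<open>14\<close>, \<open>34\<close>, \<open>23\<close> of the path; the only one of the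
  three kernels not containing that edge is \<open>\<beta>\<close>, \<open>\<pi>\<close>, \<open>\<alpha>\<close> respectively.\<close>

definition cong :: "nat set \<Rightarrow> nat rel" where
  "cong I = {(x, y) \<in> X \<times> X. (0 \<in> I \<or> (x = 1 \<longleftrightarrow> y = 1)) \<and> (1 \<in> I \<or> eps x = eps y) \<and>
                            (2 \<in> I \<or> (x = 2 \<longleftrightarrow> y = 2))}"

text \<open>The values 1 and 2 arise only from constant tuples, since \<open>eta\<close> takes only
  the values 3 and 4. Hence \<open>[x = 1]\<close> and \<open>[x = 2]\<close> turn
  \<open>H m\<close> into a conjunction. For 2 the empty tuple must be excluded, as it falls under
  the first case.\<close>

lemma H_eq_1_iff: "H m x = 1 \<longleftrightarrow> (\<forall>i\<in>{1..m}. x i = 1)"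
  by (auto simp: H_def eta_def)

lemma H_eq_2_iff: "m \<noteq> 0 \<Longrightarrow> H m x = 2 \<longleftrightarrow> (\<forall>i\<in>{1..m}. x i = 2)"
  by (auto simp: H_def eta_def)

lemma of_nat_bit_odd: "odd n \<Longrightarrow> (of_nat n :: bit) = 1"
  by (auto elim!: oddE)

lemma eps_eta [simp]: "eps (eta b) = b"
  by (cases b) (auto simp: eps_def eta_def)

text \<open>Outside the constant tuples this is \<open>eps_eta\<close>. The constant tuple 1 gives 0
  on both sides; for the constant tuple 2 the sum is \<open>m\<close> times 1, which is 1 because
  \<open>m\<close> is odd.\<close>

lemma eps_H:
  assumes "odd m"
  shows "eps (H m x) = (\<Sum>i=1..m. eps (x i))"
proof (cases "\<forall>i\<in>{1..m}. x i = 2")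
  case True
  have "m \<noteq> 0" using assms by (cases m) auto
  then have "H m x = 2" using True by (simp add: H_eq_2_iff)
  moreover have "(\<Sum>i=1..m. eps (x i)) = (\<Sum>i=1..m. 1)"
    by (rule sum.cong) (use True in \<open>auto simp: eps_def\<close>)
  ultimately show ?thesis
    using assms by (simp add: eps_def of_nat_bit_odd)
next
  case False
  show ?thesis
  proof (cases "\<forall>i\<in>{1..m}. x i = 1")
    case True
    then have "(\<Sum>i=1..m. eps (x i)) = 0"
      by (intro sum.neutral) (auto simp: eps_def)
    with True show ?thesis by (simp add: H_def eps_def)
  next
    case 1: False
    show ?thesis unfolding H_def if_not_P[OF 1] if_not_P[OF False] by simp
  qed
qed

lemma cong_in_Con:
  assumes "odd m"
  shows "cong I \<in> Con X m (H m)"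
proof -
  have "m \<noteq> 0" using assms by (cases m) auto
  have "equiv X (cong I)"
    by (rule equivI) (auto simp: cong_def refl_on_def sym_def trans_def)
  moreover have "(H m x, H m y) \<in> cong I"
    if "x \<in> {1..m} \<rightarrow>\<^sub>E X" "y \<in> {1..m} \<rightarrow>\<^sub>E X" and xy: "\<forall>i\<in>{1..m}. (x i, y i) \<in> cong I" for x y
  proof -
    have "H m x = 1 \<longleftrightarrow> H m y = 1" if "0 \<notin> I"
      unfolding H_eq_1_iff using xy that by (auto simp: cong_def)
    moreover have "eps (H m x) = eps (H m y)" if "1 \<notin> I"
      unfolding eps_H[OF assms] using xy that by (intro sum.cong) (auto simp: cong_def)
    moreover have "H m x = 2 \<longleftrightarrow> H m y = 2" if "2 \<notin> I"
      unfolding H_eq_2_iff[OF \<open>m \<noteq> 0\<close>] using xy that by (auto simp: cong_def)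
    ultimately show ?thesis
      using that H_closed by (auto simp: cong_def)
  qed
  ultimately show ?thesis
    by (simp add: Con_def compatible_def)
qed

section \<open>Every congruence is such an intersection\<close>

definition tuple3 :: "nat \<Rightarrow> nat \<Rightarrow> nat \<Rightarrow> nat \<Rightarrow> nat \<Rightarrow> nat" where
  "tuple3 m a b c = (\<lambda>i\<in>{1..m}. if i = 1 then a else if i = 2 then b else c)"

text \<open>The entry \<open>c\<close> occurs \<open>m - 2\<close> times, an odd number, so it
  contributes \<open>eps c\<close> once: on these tuples \<open>H m\<close> acts as the ternary
  operation.\<close>

lemma H_tuple3:
  assumes "odd m" "m \<ge> 3"
  shows "H m (tuple3 m a b c) =
           (if a = 1 \<and> b = 1 \<and> c = 1 then 1 else if a = 2 \<and> b = 2 \<and> c = 2 then 2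
            else eta (eps a + eps b + eps c))"
proof -
  have split: "{1..m} = {1, 2} \<union> {3..m}" using assms by auto
  have const: "(\<forall>i\<in>{1..m}. tuple3 m a b c i = d) \<longleftrightarrow> a = d \<and> b = d \<and> c = d" for d
  proof
    assume all: "\<forall>i\<in>{1..m}. tuple3 m a b c i = d"
    show "a = d \<and> b = d \<and> c = d"
      using assms bspec[OF all, of 1] bspec[OF all, of 2] bspec[OF all, of 3]
      by (simp add: tuple3_def)
  qed (simp add: tuple3_def)
  have "(\<Sum>i=1..m. eps (tuple3 m a b c i)) =
        (\<Sum>i\<in>{1, 2}. eps (tuple3 m a b c i)) + (\<Sum>i=3..m. eps (tuple3 m a b c i))"
    unfolding split by (rule sum.union_disjoint) auto
  also have "(\<Sum>i=3..m. eps (tuple3 m a b c i)) = (\<Sum>i=3..m. eps c)"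
    by (rule sum.cong) (auto simp: tuple3_def)
  also have "\<dots> = of_nat (m - 2) * eps c"
    using assms by (simp add: numeral_eq_Suc)
  also have "(of_nat (m - 2) :: bit) = 1"
    using assms by (intro of_nat_bit_odd) simp
  finally have "(\<Sum>i=1..m. eps (tuple3 m a b c i)) = eps a + eps b + eps c"
    using assms by (simp add: tuple3_def)
  then show ?thesis
    unfolding H_def const by simp
qed

lemma compatible_tuple3:
  assumes "R \<in> Con X m (H m)" and "(a, a') \<in> R" "(b, b') \<in> R" "(c, c') \<in> R"
  shows "(H m (tuple3 m a b c), H m (tuple3 m a' b' c')) \<in> R"
proof -
  have "R \<subseteq> X \<times> X" using assms by (auto simp: Con_def equiv_def refl_on_def)
  with assms have "tuple3 m a b c \<in> {1..m} \<rightarrow>\<^sub>E X" "tuple3 m a' b' c' \<in> {1..m} \<rightarrow>\<^sub>E X"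
    by (auto simp: tuple3_def)
  moreover have "\<forall>i\<in>{1..m}. (tuple3 m a b c i, tuple3 m a' b' c' i) \<in> R"
    using assms by (simp add: tuple3_def)
  ultimately show ?thesis
    using assms(1) unfolding Con_def compatible_def by blast
qed

lemma Con_eq_cong:
  assumes "odd m" "m \<ge> 3" and R: "R \<in> Con X m (H m)"
  obtains I where "I \<subseteq> {..<3}" "R = cong I"
proof
  have eq: "equiv X R" using R by (simp add: Con_def)
  have sub: "R \<subseteq> X \<times> X" using eq by (auto simp: equiv_def refl_on_def)
  have refl: "(x, x) \<in> R" if "x \<in> X" for x
    using eq that by (simp add: equiv_def refl_on_def)
  have sym: "(x, y) \<in> R \<longleftrightarrow> (y, x) \<in> R" for x y
    using eq by (meson equivE symD)
  have trans: "(x, y) \<in> R \<Longrightarrow> (y, z) \<in> R \<Longrightarrow> (x, z) \<in> R" for x y z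
    using eq by (meson equivE transD)
  have refls: "(1, 1) \<in> R" "(2, 2) \<in> R" "(3, 3) \<in> R" "(4, 4) \<in> R"
    by (auto intro!: refl simp: X_def)
  note t = compatible_tuple3[OF R, unfolded H_tuple3[OF assms(1,2)]]
  \<comment> \<open>Compare the value 1 at (1,1,1) with 3 at (2,1,1) and with 4 at (2,2,1). Below,
    (3,3,1) gives 4, and (4,4,2) gives 3 against the value 2 at (2,2,2).\<close>
  have "(1, 3) \<in> R" "(1, 4) \<in> R" if "(1, 2) \<in> R"
    using t[OF that refls(1) refls(1)] t[OF that that refls(1)] by (auto simp: eps_def eta_def)
  moreover have "(1, 4) \<in> R" if "(1, 3) \<in> R"
    using t[OF that that refls(1)] by (auto simp: eps_def eta_def)
  moreover have "(2, 3) \<in> R" if "(2, 4) \<in> R"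
    using t[OF that that refls(2)] by (auto simp: eps_def eta_def)
  \<comment> \<open>From right to left this is transitivity along the path; from left to right, the
    evaluations give one edge and transitivity the rest.\<close>
  ultimately have paths: "(1, 3) \<in> R \<longleftrightarrow> (1, 4) \<in> R \<and> (3, 4) \<in> R"
    "(2, 4) \<in> R \<longleftrightarrow> (2, 3) \<in> R \<and> (3, 4) \<in> R"
    "(1, 2) \<in> R \<longleftrightarrow> (1, 4) \<in> R \<and> (3, 4) \<in> R \<and> (2, 3) \<in> R"
    using sym trans by meson+
  define I :: "nat set" where
    "I = (if (1, 4) \<in> R then {0} else {}) \<union> (if (3, 4) \<in> R then {1} else {}) \<union>
         (if (2, 3) \<in> R then {2} else {})"
  show "I \<subseteq> {..<3}"
    by (auto simp: I_def)
  have mem: "0 \<in> I \<longleftrightarrow> (1, 4) \<in> R" "1 \<in> I \<longleftrightarrow> (3, 4) \<in> R" "2 \<in> I \<longleftrightarrow> (2, 3) \<in> R"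
    by (auto simp: I_def)
  have syms: "(4, 1) \<in> R \<longleftrightarrow> (1, 4) \<in> R" "(4, 3) \<in> R \<longleftrightarrow> (3, 4) \<in> R" "(3, 2) \<in> R \<longleftrightarrow> (2, 3) \<in> R"
    "(3, 1) \<in> R \<longleftrightarrow> (1, 3) \<in> R" "(4, 2) \<in> R \<longleftrightarrow> (2, 4) \<in> R" "(2, 1) \<in> R \<longleftrightarrow> (1, 2) \<in> R"
    by (rule sym)+
  \<comment> \<open>Up to symmetry there are six pairs of distinct elements: the three edges,
    decided by \<open>I\<close>, and three longer pairs, which \<open>paths\<close> reduces to
    edges.\<close>
  have "(x, y) \<in> R \<longleftrightarrow> (x, y) \<in> cong I" if "x \<in> X" "y \<in> X" for x y
    using that unfolding cong_def mem X_def
    by (elim insertE emptyE) (simp_all add: refls[simplified] syms[simplified] paths[simplified] eps_def, blast+)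
  with sub show "R = cong I"
    by (auto simp: cong_def)
qed

section \<open>The congruence lattice and the named partitions\<close>

lemma Con_eq_image:
  assumes "odd m" "m \<ge> 3"
  shows "Con X m (H m) = cong ` Pow {..<3}"
  using cong_in_Con[OF assms(1)] Con_eq_cong[OF assms] by blast

interpretation cong: powerset_embedding "{..<3}" cong
proof
  fix I J :: "nat set"
  assume IJ: "I \<subseteq> {..<3}" "J \<subseteq> {..<3}"
  show "cong I \<subseteq> cong J \<longleftrightarrow> I \<subseteq> J"
  proof
    assume sub: "cong I \<subseteq> cong J"
    \<comment> \<open>The endpoints of an edge are separated by exactly one of the three kernels, so
      each edge tests membership of one index.\<close>
    have edges: "(1, 4) \<in> cong K \<longleftrightarrow> 0 \<in> K" "(3, 4) \<in> cong K \<longleftrightarrow> 1 \<in> K" "(2, 3) \<in> cong K \<longleftrightarrow> 2 \<in> K"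
      for K by (auto simp: cong_def X_def eps_def)
    have "0 \<in> I \<longrightarrow> 0 \<in> J" "1 \<in> I \<longrightarrow> 1 \<in> J" "2 \<in> I \<longrightarrow> 2 \<in> J"
      using sub edges by blast+
    moreover have "i = 0 \<or> i = 1 \<or> i = 2" if "i \<in> I" for i
      using that IJ(1) by auto
    ultimately show "I \<subseteq> J" by blast
  next
    assume "I \<subseteq> J"
    then have "0 \<in> I \<Longrightarrow> 0 \<in> J" "1 \<in> I \<Longrightarrow> 1 \<in> J" "2 \<in> I \<Longrightarrow> 2 \<in> J"
      by (simp_all add: subsetD)
    then show "cong I \<subseteq> cong J"
      unfolding cong_def by (intro subrelI) (simp split: prod.splits, metis)
  qed
qed

lemma rel_of_partition_eq_cong:
  assumes "\<Union>P \<subseteq> X" and "\<forall>x\<in>X. \<forall>y\<in>X. (\<exists>B\<in>P. x \<in> B \<and> y \<in> B) \<longleftrightarrow> (x, y) \<in> cong I"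
  shows "rel_of_partition P = cong I"
proof -
  have "(x, y) \<in> rel_of_partition P \<longleftrightarrow> (x, y) \<in> cong I" for x y
  proof (cases "x \<in> X \<and> y \<in> X")
    case True
    then show ?thesis using assms(2) by (simp add: rel_of_partition_def)
  next
    case False
    then have "(x, y) \<notin> cong I" by (auto simp: cong_def)
    moreover have "(x, y) \<notin> rel_of_partition P"
      using False assms(1) by (auto simp: rel_of_partition_def)
    ultimately show ?thesis by simp
  qed
  then show ?thesis by auto
qed

text \<open>The blocks of \<open>cong I\<close> are the segments of the path 1 - 4 - 3 - 2 left
  after deleting the edges not in \<open>I\<close>.\<close>

lemma named_eqs:
  "eq_Delta = cong {}" "eq_mu = cong {0}" "eq_nu = cong {1}" "eq_lambda = cong {2}"
  "eq_alpha = cong {0, 1}" "eq_pi = cong {0, 2}" "eq_beta = cong {1, 2}" "eq_nabla = cong {0, 1, 2}"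
  unfolding eq_Delta_def eq_mu_def eq_nu_def eq_lambda_def eq_alpha_def eq_pi_def eq_beta_def
    eq_nabla_def
  by (rule rel_of_partition_eq_cong; simp add: cong_def X_def eps_def)+

theorem corollary6p3:
  fixes m :: nat
  assumes "odd m" and "m \<ge> 3"
  shows "Con X m (H m) =
           {eq_Delta, eq_lambda, eq_mu, eq_nu, eq_alpha, eq_pi, eq_beta, eq_nabla}
       \<and> lattice (inclusion_order (Con X m (H m)))
       \<and> lattice_isomorphic (inclusion_order (Con X m (H m))) (boolean_lattice 3)
       \<and> atoms (inclusion_order (Con X m (H m))) = {eq_lambda, eq_mu, eq_nu}
       \<and> eq_lambda \<squnion>\<^bsub>inclusion_order (Con X m (H m))\<^esub> eq_mu = eq_pi
       \<and> eq_mu \<squnion>\<^bsub>inclusion_order (Con X m (H m))\<^esub> eq_nu = eq_alpha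
       \<and> eq_lambda \<squnion>\<^bsub>inclusion_order (Con X m (H m))\<^esub> eq_nu = eq_beta"
proof -
  have three: "{..<3} = {0, 1, 2 :: nat}" by auto
  have "cong ` Pow {..<3} =
      {eq_Delta, eq_lambda, eq_mu, eq_nu, eq_alpha, eq_pi, eq_beta, eq_nabla}"
    unfolding three named_eqs by (auto simp: Pow_insert)
  moreover have "atoms (inclusion_order (cong ` Pow {..<3})) = {eq_lambda, eq_mu, eq_nu}"
    unfolding cong.atoms unfolding three named_eqs by auto
  moreover have "eq_lambda \<squnion>\<^bsub>cong.L\<^esub> eq_mu = eq_pi" "eq_mu \<squnion>\<^bsub>cong.L\<^esub> eq_nu = eq_alpha"
      "eq_lambda \<squnion>\<^bsub>cong.L\<^esub> eq_nu = eq_beta"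
    unfolding named_eqs by (simp_all add: cong.join insert_commute)
  ultimately show ?thesis
    unfolding Con_eq_image[OF assms] boolean_lattice_def
    using cong.lattice cong.lattice_isomorphic by blast
qed

end
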